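(* Let $\Delta\neq\mathbb{N}$ be a numerical semigroup, let $d\ge2$ be an integer, and let $S$ be a numerical semigroup with $S/d=\Delta$. If $A=\operatorname{msg}_{\mathcal{M}_d(\Delta)}(S)$ is the minimal $\mathcal{M}_d(\Delta)$-system of generators of $S$, then (1) $\operatorname{msg}(S)=A\cup\{dn: n\in\operatorname{msg}(\Delta),\ dn\notin\langle A\rangle\}$; (2) $\operatorname{e}(S)=\operatorname{e}(\Delta)+|A|-\left|\{n\in\operatorname{msg}(\Delta): dn\in\langle A\rangle\}\right|$.
   Context: $\mathbb{N}=\{0,1,2,\dots\}$. A numerical semigroup is a submonoid of $(\mathbb{N},+)$ with finite complement in $\mathbb{N}$; $\operatorname{msg}(S)$ denotes its unique minimal system of generators and $\operatorname{e}(S)=|\operatorname{msg}(S)|$. For $A\subseteq\mathbb{N}$, $A/d=\{x\in\mathbb{N}: dx\in A\}$ and $dA=\{dx:x\in A\}$; $A+B=\{a+b:a\in A,b\in B\}$; $\langle X\rangle$ is the submonoid of $(\mathbb{N},+)$ generated by $X$. An $\mathcal{M}_d(\Delta)$-monoid is a submonoid $M$ of $(\mathbb{N},+)$ with $M/d=\Delta$. A subset $X\subseteq M$ is an $\mathcal{M}_d(\Delta)$-system of generators of $M$ if $M=\langle X\rangle+d\Delta$; it is minimal if no proper subset of $X$ has this property. Every $\mathcal{M}_d(\Delta)$-monoid $M$ has a unique minimal $\mathcal{M}_d(\Delta)$-system of generators, denoted $\operatorname{msg}_{\mathcal{M}_d(\Delta)}(M)$ (it equals $\operatorname{msg}(M)\setminus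 d\Delta$). *)

theory Defs
  imports "HOL.Hull" "HOL-Library.Set_Algebras"
begin

definition submonoid :: "nat set \<Rightarrow> bool" where
  "submonoid M \<longleftrightarrow> 0 \<in> M \<and> (\<forall>x\<in>M. \<forall>y\<in>M. x + y \<in> M)"

definition numerical_semigroup :: "nat set \<Rightarrow> bool" where
  "numerical_semigroup S \<longleftrightarrow> submonoid S \<and> finite (- S)"

definition generated :: "nat set \<Rightarrow> nat set" where
  "generated X = submonoid hull X"

definition set_quotient :: "nat set \<Rightarrow> nat \<Rightarrow> nat set" where
  "set_quotient A d = {x. d * x \<in> A}"

definition dilate :: "nat \<Rightarrow> nat set \<Rightarrow> nat set" where
  "dilate d A = (\<lambda>x. d * x) ` A"

definition generators :: "nat set \<Rightarrow> nat set \<Rightarrow> bool" where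
  "generators M X \<longleftrightarrow> M = generated X"

definition minimal_generators :: "nat set \<Rightarrow> nat set \<Rightarrow> bool" where
  "minimal_generators M X \<longleftrightarrow> generators M X \<and> (\<forall>Y. Y \<subset> X \<longrightarrow> \<not> generators M Y)"

text \<open>The two uses of \<open>THE\<close> below are justified by the lemmas \<open>ex1_minimal_generators\<close>
  and \<open>ex1_minimal_Md_generators\<close>.\<close>

definition msg :: "nat set \<Rightarrow> nat set" where
  "msg M = (THE X. minimal_generators M X)"

definition embedding_dim :: "nat set \<Rightarrow> nat" where
  "embedding_dim S = card (msg S)"

definition Md_monoid :: "nat \<Rightarrow> nat set \<Rightarrow> nat set \<Rightarrow> bool" where
  "Md_monoid d \<Delta> M \<longleftrightarrow> submonoid M \<and> set_quotient M d = \<Delta>"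

definition Md_generators :: "nat \<Rightarrow> nat set \<Rightarrow> nat set \<Rightarrow> nat set \<Rightarrow> bool" where
  "Md_generators d \<Delta> M X \<longleftrightarrow> X \<subseteq> M \<and> M = generated X + dilate d \<Delta>"

definition minimal_Md_generators :: "nat \<Rightarrow> nat set \<Rightarrow> nat set \<Rightarrow> nat set \<Rightarrow> bool" where
  "minimal_Md_generators d \<Delta> M X \<longleftrightarrow>
     Md_generators d \<Delta> M X \<and> (\<forall>Y. Y \<subset> X \<longrightarrow> \<not> Md_generators d \<Delta> M Y)"

definition msg_Md :: "nat \<Rightarrow> nat set \<Rightarrow> nat set \<Rightarrow> nat set" where
  "msg_Md d \<Delta> M = (THE X. minimal_Md_generators d \<Delta> M X)"

lemma submonoid_generated: "submonoid (generated X)"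
  unfolding generated_def by (rule hull_in) (auto simp: submonoid_def)

lemma generated_superset: "X \<subseteq> generated X"
  unfolding generated_def by (rule hull_subset)

lemma generated_least: "X \<subseteq> M \<Longrightarrow> submonoid M \<Longrightarrow> generated X \<subseteq> M"
  unfolding generated_def by (rule hull_minimal)

lemma generated_cases:
  assumes "x \<in> generated X"
  shows "x = 0 \<or> x \<in> X \<or> (\<exists>a\<in>generated X - {0}. \<exists>b\<in>generated X - {0}. x = a + b)"
proof -
  let ?N = "{x \<in> generated X. x = 0 \<or> x \<in> X \<or>
    (\<exists>a\<in>generated X - {0}. \<exists>b\<in>generated X - {0}. x = a + b)}"
  have "x + y \<in> ?N" if "x \<in> ?N" "y \<in> ?N" for x y
  proof (cases "x = 0 \<or> y = 0")
    case True
    then have "x + y = x \<or> x + y = y" by auto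
    then show ?thesis
    proof
      assume eq: "x + y = x"
      show ?thesis by (subst eq) (rule that(1))
    next
      assume eq: "x + y = y"
      show ?thesis by (subst eq) (rule that(2))
    qed
  next
    case False
    then have "x \<in> generated X - {0}" "y \<in> generated X - {0}" using that by auto
    moreover from this have "x + y \<in> generated X"
      using submonoid_generated[of X] by (simp add: submonoid_def)
    ultimately show ?thesis by (intro CollectI conjI disjI2 bexI[of _ x] bexI[of _ y] refl)
  qed
  moreover have "0 \<in> ?N"
    using submonoid_generated[of X] by (simp add: submonoid_def)
  ultimately have "submonoid ?N" unfolding submonoid_def by (intro conjI ballI)
  then have "generated X \<subseteq> ?N"
    using generated_superset by (intro generated_least) auto
  with assms show ?thesis by blast
qed

text \<open>Generation modulo a submonoid \<open>D\<close> of \<open>M\<close>; ordinary generation is the case \<open>D = {0}\<close>.\<close>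

lemma ex1_minimal_relative:
  assumes M: "submonoid M" and D: "submonoid D" "D \<subseteq> M"
  defines "P \<equiv> \<lambda>X. X \<subseteq> M \<and> M = generated X + D"
  shows "\<exists>!X. P X \<and> (\<forall>Y. Y \<subset> X \<longrightarrow> \<not> P Y)"
proof -
  define I where "I = {x \<in> M - D. \<not> (\<exists>a\<in>M - {0}. \<exists>b\<in>M - {0}. x = a + b)}"
  have zero: "0 \<in> D" using D by (simp add: submonoid_def)
  have least: "I \<subseteq> X" if "P X" for X
  proof
    fix x assume x: "x \<in> I"
    have X: "X \<subseteq> M" and eq: "M = generated X + D"
      using that unfolding P_def by blast+
    have xM: "x \<in> M" "x \<notin> D"
      and irred: "\<And>a b. a \<in> M \<Longrightarrow> b \<in> M \<Longrightarrow> x = a + b \<Longrightarrow> a = 0 \<or> b = 0"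
      using x unfolding I_def by blast+
    have GM: "generated X \<subseteq> M" using X M by (intro generated_least)
    from xM(1)[unfolded eq] obtain a b where ab: "a \<in> generated X" "b \<in> D" "x = a + b"
      by (rule set_plus_elim)
    have "a \<noteq> 0"
    proof
      assume "a = 0"
      with ab have "x \<in> D" by simp
      with xM show False by simp
    qed
    then have "b = 0" using irred[of a b] ab GM D by auto
    with ab have "x \<in> generated X" by simp
    moreover have "x \<noteq> 0" using xM zero by metis
    ultimately consider "x \<in> X"
      | a b where "a \<in> generated X - {0}" "b \<in> generated X - {0}" "x = a + b"
      using generated_cases by blast
    then show "x \<in> X"
    proof cases
      case (2 a b)
      then show ?thesis using irred[of a b] GM by auto
    qed
  qed
  have "x \<in> generated I + D" if "x \<in> M" for x
    using that
  proof (induction x rule: less_induct)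
    case (less x)
    consider "x \<in> D" | "x \<in> I" | a b where "a \<in> M - {0}" "b \<in> M - {0}" "x = a + b"
      using less.prems unfolding I_def by blast
    then show ?case
    proof cases
      case 1
      then show ?thesis
        using set_plus_intro[of 0 "generated I" x D] submonoid_generated[of I]
        by (simp add: submonoid_def)
    next
      case 2
      then show ?thesis
        using set_plus_intro[of x "generated I" 0 D] generated_superset[of I] zero by auto
    next
      case 3
      then have "a \<in> generated I + D" "b \<in> generated I + D"
        using less.IH by auto
      then obtain p q r s where "p \<in> generated I" "q \<in> D" "r \<in> generated I" "s \<in> D"
        "a = p + q" "b = r + s" by (auto elim!: set_plus_elim)
      then have "p + r \<in> generated I" "q + s \<in> D" "x = (p + r) + (q + s)"
        using 3 D submonoid_generated[of I] by (auto simp: submonoid_def)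
      then show ?thesis using set_plus_intro by blast
    qed
  qed
  moreover have "generated I + D \<subseteq> M"
  proof
    fix x assume "x \<in> generated I + D"
    then obtain a b where "a \<in> generated I" "b \<in> D" "x = a + b"
      by (auto elim: set_plus_elim)
    moreover have "generated I \<subseteq> M" using M by (intro generated_least) (auto simp: I_def)
    ultimately have "a \<in> M" "b \<in> M" "x = a + b" using D by auto
    with M show "x \<in> M" by (simp add: submonoid_def)
  qed
  moreover have "I \<subseteq> M" by (auto simp: I_def)
  ultimately have PI: "P I" unfolding P_def by blast
  show ?thesis
  proof (rule ex1I[of _ I])
    show "P I \<and> (\<forall>Y. Y \<subset> I \<longrightarrow> \<not> P Y)" using PI least by blast
    show "X = I" if "P X \<and> (\<forall>Y. Y \<subset> X \<longrightarrow> \<not> P Y)" for X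
      using that PI least[of X] by blast
  qed
qed

lemma ex1_minimal_generators:
  assumes "submonoid M"
  shows "\<exists>!X. minimal_generators M X"
proof -
  have "generators M X \<longleftrightarrow> X \<subseteq> M \<and> M = generated X + {0}" for X
    using generated_superset[of X] by (auto simp: generators_def set_plus_def)
  moreover have "submonoid {0}" "{0} \<subseteq> M" using assms by (auto simp: submonoid_def)
  ultimately show ?thesis
    using ex1_minimal_relative[OF assms, of "{0}"] unfolding minimal_generators_def by simp
qed

lemma ex1_minimal_Md_generators:
  assumes "Md_monoid d \<Delta> M"
  shows "\<exists>!X. minimal_Md_generators d \<Delta> M X"
proof -
  have M: "submonoid M" and \<Delta>: "\<Delta> = set_quotient M d"
    using assms by (auto simp: Md_monoid_def)
  have "0 \<in> dilate d \<Delta>"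
    using M unfolding \<Delta> by (auto simp: submonoid_def set_quotient_def dilate_def)
  moreover have "x + y \<in> dilate d \<Delta>" if "x \<in> dilate d \<Delta>" "y \<in> dilate d \<Delta>" for x y
  proof -
    from that obtain u v where "x = d * u" "y = d * v" "d * u \<in> M" "d * v \<in> M"
      unfolding \<Delta> by (auto simp: set_quotient_def dilate_def)
    then have "x + y = d * (u + v)" "d * (u + v) \<in> M"
      using M by (auto simp: submonoid_def distrib_left)
    then show ?thesis unfolding \<Delta> by (auto simp: set_quotient_def dilate_def)
  qed
  ultimately have "submonoid (dilate d \<Delta>)" by (simp add: submonoid_def)
  moreover have "dilate d \<Delta> \<subseteq> M" unfolding \<Delta> by (auto simp: set_quotient_def dilate_def)
  ultimately show ?thesis
    using ex1_minimal_relative[OF M, of "dilate d \<Delta>"]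
    unfolding minimal_Md_generators_def Md_generators_def by simp
qed

end

(* Both minimal systems are sets of atoms (nonzero elements that are not sums of two nonzero
   elements): msg(S) is the set of atoms of S, and A consists of the atoms of S outside d\<Delta>.
   The atoms of S inside d\<Delta> remain to be found. If dn is one of them, then n is an atom of \<Delta>,
   and dn is not in \<langle>A\<rangle> since an atom lying in \<langle>A\<rangle> lies in A. Conversely, let n be an atom of \<Delta>
   with dn not in \<langle>A\<rangle>, and write a decomposition of dn in S = \<langle>A\<rangle> + d\<Delta> as
   (p + dq) + (r + ds). Then p + r is a multiple dm with m in \<Delta>, so n = m + (q + s); either q + s = 0
   and dn = p + r is in \<langle>A\<rangle>, or p = r = 0 and n = q + s, so that the decomposition is trivial. *)

theory Submission
  imports Defs
begin

definition atoms :: "nat set \<Rightarrow> nat set" where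
  "atoms M = {x \<in> M - {0}. \<forall>a\<in>M. \<forall>b\<in>M. x = a + b \<longrightarrow> a = 0 \<or> b = 0}"

lemma atomsD:
  assumes "x \<in> atoms M"
  shows "x \<in> M" "x \<noteq> 0" "\<And>a b. a \<in> M \<Longrightarrow> b \<in> M \<Longrightarrow> x = a + b \<Longrightarrow> a = 0 \<or> b = 0"
  using assms by (auto simp: atoms_def)

text \<open>By \<open>generated_cases\<close>, a nonzero element of \<open>generated X\<close>
  outside \<open>X\<close> is a sum of two nonzero elements of \<open>generated X\<close>, hence of
  \<open>M\<close>; an atom of \<open>M\<close> admits no such sum.\<close>

lemma atom_in_generatedD:
  assumes "x \<in> generated X" "generated X \<subseteq> M" "x \<in> atoms M"
  shows "x \<in> X"
  using generated_cases[OF assms(1)] atomsD[OF assms(3)] assms(2) by blast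

text \<open>An atom written as \<open>a + b\<close> with \<open>a\<close> in
  \<open>generated X\<close> and \<open>b\<close> in \<open>D\<close> has a zero summand. Being
  outside \<open>D\<close>, it cannot equal \<open>b\<close>, so it equals \<open>a\<close>. Both
  kinds of minimal system are covered: \<open>D\<close> is \<open>{0}\<close> for \<open>msg\<close>
  and \<open>dilate d \<Delta>\<close> for \<open>msg_Md\<close>.\<close>

lemma atoms_diff_subset_relative_generators:
  assumes M: "submonoid M" and "D \<subseteq> M" and "X \<subseteq> M" and eq: "M = generated X + D"
  shows "atoms M - D \<subseteq> X"
proof
  fix x assume x: "x \<in> atoms M - D"
  have GM: "generated X \<subseteq> M" using assms by (intro generated_least)
  from x eq have "x \<in> generated X + D" using atomsD(1) by blast
  then obtain a b where ab: "a \<in> generated X" "b \<in> D" "x = a + b"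
    by (rule set_plus_elim)
  with x GM \<open>D \<subseteq> M\<close> have "a = 0 \<or> b = 0" using atomsD(3)[of x M a b] by blast
  with ab x have "x \<in> generated X" by auto
  then show "x \<in> X" using GM x atom_in_generatedD by blast
qed

text \<open>Strong induction: a nonzero element that is not an atom splits into two strictly smaller
  elements of \<open>M\<close>, and commutativity lets their generated parts and their
  \<open>D\<close>-parts be collected separately.\<close>

lemma relative_generators_atoms_diff:
  assumes M: "submonoid M" and D: "submonoid D" "D \<subseteq> M"
  shows "M = generated (atoms M - D) + D"
proof
  let ?G = "generated (atoms M - D)"
  have G: "submonoid ?G" by (rule submonoid_generated)
  have "?G \<subseteq> M" using M by (intro generated_least) (auto simp: atoms_def)
  then show "?G + D \<subseteq> M"
    using M D by (auto simp: submonoid_def elim!: set_plus_elim)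
  have "x \<in> ?G + D" if "x \<in> M" for x
    using that
  proof (induction x rule: less_induct)
    case (less x)
    have zero: "0 \<in> ?G" "0 \<in> D" using G D by (auto simp: submonoid_def)
    consider "x \<in> D" | "x \<in> atoms M - D"
      | a b where "a \<in> M - {0}" "b \<in> M - {0}" "x = a + b"
      using less.prems zero unfolding atoms_def by blast
    then show ?case
    proof cases
      case 1
      then show ?thesis using set_plus_intro[of 0 ?G x D] zero by simp
    next
      case 2
      then have "x \<in> ?G" using generated_superset by blast
      then show ?thesis using set_plus_intro[of x ?G 0 D] zero by simp
    next
      case 3
      then have "a \<in> ?G + D" "b \<in> ?G + D" using less.IH by auto
      then obtain p q r s where "p \<in> ?G" "q \<in> D" "r \<in> ?G" "s \<in> D" "a = p + q" "b = r + s"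
        by (auto elim!: set_plus_elim)
      then have "p + r \<in> ?G" "q + s \<in> D" "x = (p + r) + (q + s)"
        using 3 D G by (auto simp: submonoid_def)
      then show ?thesis using set_plus_intro by blast
    qed
  qed
  then show "M \<subseteq> ?G + D" by blast
qed

lemma msg_eq_atoms:
  assumes M: "submonoid M"
  shows "msg M = atoms M"
proof -
  \<comment> \<open>Adding \<open>{0}\<close> changes nothing, so ordinary generation is generation
    relative to \<open>D = {0}\<close>.\<close>
  have rel: "generators M X \<longleftrightarrow> X \<subseteq> M \<and> M = generated X + {0}" for X
    using generated_superset[of X] by (auto simp: generators_def set_plus_def)
  have D: "submonoid {0}" "{0} \<subseteq> M" and "atoms M - {0} = atoms M"
    using M by (auto simp: submonoid_def atoms_def)
  then have "generators M (atoms M)"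
    using relative_generators_atoms_diff[OF M D] rel by (auto simp: atoms_def)
  moreover have "atoms M \<subseteq> X" if "generators M X" for X
    using atoms_diff_subset_relative_generators[OF M D(2)] that rel \<open>atoms M - {0} = atoms M\<close>
    by metis
  ultimately have "minimal_generators M (atoms M)"
    unfolding minimal_generators_def by blast
  then show ?thesis
    unfolding msg_def by (rule the1_equality[OF ex1_minimal_generators[OF M]])
qed

lemma submonoid_set_quotient: "submonoid M \<Longrightarrow> submonoid (set_quotient M d)"
  by (auto simp: submonoid_def set_quotient_def distrib_left)

lemma submonoid_dilate: "submonoid M \<Longrightarrow> submonoid (dilate d M)"
  unfolding submonoid_def dilate_def by (auto simp flip: distrib_left)

lemma dilate_set_quotient_subset: "dilate d (set_quotient M d) \<subseteq> M"
  by (auto simp: dilate_def set_quotient_def)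

lemma Md_generators_atoms_diff:
  assumes "Md_monoid d \<Delta> M"
  shows "Md_generators d \<Delta> M (atoms M - dilate d \<Delta>)"
proof -
  have M: "submonoid M" and \<Delta>: "\<Delta> = set_quotient M d"
    using assms by (auto simp: Md_monoid_def)
  have "M = generated (atoms M - dilate d \<Delta>) + dilate d \<Delta>"
    unfolding \<Delta> using M
    by (intro relative_generators_atoms_diff submonoid_dilate submonoid_set_quotient
        dilate_set_quotient_subset)
  then show ?thesis unfolding Md_generators_def by (auto simp: atoms_def)
qed

lemma msg_Md_eq_atoms_diff:
  assumes Md: "Md_monoid d \<Delta> M"
  shows "msg_Md d \<Delta> M = atoms M - dilate d \<Delta>"
proof -
  have M: "submonoid M" and D: "dilate d \<Delta> \<subseteq> M"
    using Md dilate_set_quotient_subset by (auto simp: Md_monoid_def)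
  have "atoms M - dilate d \<Delta> \<subseteq> X" if "Md_generators d \<Delta> M X" for X
    using that atoms_diff_subset_relative_generators[OF M D] unfolding Md_generators_def by blast
  then have "minimal_Md_generators d \<Delta> M (atoms M - dilate d \<Delta>)"
    unfolding minimal_Md_generators_def using Md_generators_atoms_diff[OF Md] by blast
  then show ?thesis
    unfolding msg_Md_def by (rule the1_equality[OF ex1_minimal_Md_generators[OF Md]])
qed

lemma finite_atoms:
  assumes "numerical_semigroup M"
  shows "finite (atoms M)"
proof -
  from assms obtain c where c: "\<And>x. x \<notin> M \<Longrightarrow> x < c"
    by (auto simp: numerical_semigroup_def finite_nat_set_iff_bounded)
  have "x \<le> 2 * c + 1" if x: "x \<in> atoms M" for x
  proof (rule ccontr)
    assume "\<not> x \<le> 2 * c + 1"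
    \<comment> \<open>Everything from \<open>c\<close> on lies in \<open>M\<close>, so both summands
      do; taking \<open>c + 1\<close> instead of \<open>c\<close> keeps them nonzero even when
      \<open>c = 0\<close>.\<close>
    then have "x = (c + 1) + (x - (c + 1))" "x - (c + 1) \<ge> c + 1" by auto
    then show False using atomsD(3)[OF x, of "c + 1" "x - (c + 1)"] c by fastforce
  qed
  then show ?thesis by (auto simp: finite_nat_set_iff_bounded_le)
qed

lemma atoms_Int_dilate_set_quotient:
  assumes Md: "Md_monoid d \<Delta> M" and d: "d > 0"
  defines "A \<equiv> atoms M - dilate d \<Delta>"
  shows "atoms M \<inter> dilate d \<Delta> = (\<lambda>n. d * n) ` {n \<in> atoms \<Delta>. d * n \<notin> generated A}"
proof -
  have M: "submonoid M" and \<Delta>: "\<And>n. n \<in> \<Delta> \<longleftrightarrow> d * n \<in> M"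
    using Md by (auto simp: Md_monoid_def set_quotient_def)
  have GM: "generated A \<subseteq> M" using M by (intro generated_least) (auto simp: A_def atoms_def)
  have eq: "M = generated A + dilate d \<Delta>"
    using Md_generators_atoms_diff[OF Md] unfolding A_def Md_generators_def by blast
  have "n \<in> atoms \<Delta> \<and> d * n \<notin> generated A" if x: "d * n \<in> atoms M" and n: "n \<in> \<Delta>" for n
  proof
    \<comment> \<open>A decomposition of \<open>n\<close> in \<open>\<Delta>\<close> scales by
      \<open>d\<close> to one of \<open>d * n\<close> in \<open>M\<close>.\<close>
    have "a = 0 \<or> b = 0" if "a \<in> \<Delta>" "b \<in> \<Delta>" "n = a + b" for a b
      using atomsD(3)[OF x, of "d * a" "d * b"] that \<Delta> d by (auto simp: distrib_left)
    then show "n \<in> atoms \<Delta>" using n atomsD(2)[OF x] by (auto simp: atoms_def)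
    show "d * n \<notin> generated A"
      using atom_in_generatedD[OF _ GM x] n by (auto simp: A_def dilate_def)
  qed
  moreover have "d * n \<in> atoms M" if n: "n \<in> atoms \<Delta>" and nA: "d * n \<notin> generated A" for n
  proof -
    have "a = 0 \<or> b = 0" if ab: "a \<in> M" "b \<in> M" "d * n = a + b" for a b
    proof -
      from ab eq have "a \<in> generated A + dilate d \<Delta>" "b \<in> generated A + dilate d \<Delta>" by auto
      then obtain p q r s where pr: "p \<in> generated A" "r \<in> generated A" and qs: "q \<in> \<Delta>" "s \<in> \<Delta>"
        and a: "a = p + d * q" and b: "b = r + d * s"
        by (auto simp: dilate_def elim!: set_plus_elim)
      have pr_in: "p + r \<in> generated A"
        using pr submonoid_generated[of A] by (simp add: submonoid_def)
      have sum: "d * n = (p + r) + d * (q + s)" using ab a b by (simp add: distrib_left)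
      \<comment> \<open>The sum \<open>p + r\<close> is what remains of one multiple of
        \<open>d\<close> after removing another; its quotient \<open>m\<close> lies in
        \<open>\<Delta>\<close> because \<open>\<Delta>\<close> is the quotient of \<open>M\<close>
        by \<open>d\<close>.\<close>
      then have "d dvd p + r" by (metis dvd_add_left_iff dvd_triv_left)
      then obtain m where m: "p + r = d * m" ..
      with sum have "d * n = d * (m + (q + s))" by (simp add: distrib_left)
      with d have n_eq: "n = m + (q + s)" by simp
      have "m \<in> \<Delta>" using m pr_in GM \<Delta> by auto
      moreover have "q + s \<in> \<Delta>"
        using qs M \<Delta> by (simp add: submonoid_def distrib_left)
      ultimately have "m = 0 \<or> q + s = 0" using atomsD(3)[OF n] n_eq by blast
      moreover have "q + s \<noteq> 0" using sum pr_in nA by (metis add.right_neutral mult_0_right)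
      ultimately have "m = 0" by blast
      \<comment> \<open>A zero sum of naturals has zero summands, so \<open>a = d * q\<close> and
        \<open>b = d * s\<close>, and the atom \<open>n = q + s\<close> forces \<open>q\<close> or
        \<open>s\<close> to vanish.\<close>
      then have "p = 0" "r = 0" "n = q + s" using m n_eq by auto
      then show ?thesis using atomsD(3)[OF n qs] a b by auto
    qed
    moreover have "d * n \<in> M" "d * n \<noteq> 0" using atomsD(1,2)[OF n] \<Delta> d by auto
    ultimately show ?thesis by (auto simp: atoms_def)
  qed
  ultimately show ?thesis using atomsD(1)[of _ \<Delta>] unfolding dilate_def by blast
qed

theorem proposition4p9:
  fixes \<Delta> S A :: "nat set" and d :: nat
  assumes "numerical_semigroup \<Delta>" and "\<Delta> \<noteq> UNIV"
    and "d \<ge> 2"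
    and "numerical_semigroup S" and "set_quotient S d = \<Delta>"
    and "A = msg_Md d \<Delta> S"
  shows "msg S = A \<union> {d * n | n. n \<in> msg \<Delta> \<and> d * n \<notin> generated A} \<and>
    int (embedding_dim S) =
      int (embedding_dim \<Delta>) + int (card A) - int (card {n \<in> msg \<Delta>. d * n \<in> generated A})"
proof -
  have S: "submonoid S" and D: "submonoid \<Delta>"
    using assms by (auto simp: numerical_semigroup_def)
  have Md: "Md_monoid d \<Delta> S" using S assms by (simp add: Md_monoid_def)
  have A: "A = atoms S - dilate d \<Delta>" using assms msg_Md_eq_atoms_diff[OF Md] by simp
  let ?N = "{n \<in> msg \<Delta>. d * n \<notin> generated A}" and ?G = "{n \<in> msg \<Delta>. d * n \<in> generated A}"
  let ?B = "(\<lambda>n. d * n) ` ?N"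
  have B: "atoms S \<inter> dilate d \<Delta> = ?B"
    using atoms_Int_dilate_set_quotient[OF Md] \<open>d \<ge> 2\<close> msg_eq_atoms[OF D] A by simp
  have msg: "msg S = A \<union> ?B" and disj: "A \<inter> ?B = {}"
    unfolding B[symmetric] using A msg_eq_atoms[OF S] by auto
  have fin: "finite (msg \<Delta>)" "finite (msg S)"
    using assms finite_atoms msg_eq_atoms S D by simp_all
  have "card ?B = card ?N" using \<open>d \<ge> 2\<close> by (intro card_image) (auto simp: inj_on_def)
  \<comment> \<open>Finiteness of \<open>A\<close> comes from its inclusion in \<open>msg S\<close>.
    Eliminating \<open>card ?N\<close> between this equation and the next one gives the
    formula.\<close>
  then have "embedding_dim S = card A + card ?N"
    unfolding embedding_dim_def msg using fin(2) msg disj by (subst card_Un_disjoint) auto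
  moreover have "embedding_dim \<Delta> = card ?N + card ?G"
  proof -
    have "msg \<Delta> = ?N \<union> ?G" by blast
    then have "card (msg \<Delta>) = card (?N \<union> ?G)" by simp
    also have "\<dots> = card ?N + card ?G" using fin(1) by (intro card_Un_disjoint) auto
    finally show ?thesis unfolding embedding_dim_def .
  qed
  ultimately show ?thesis using msg by auto
qed

end
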